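(* Let $F : I \to \mathbb{R}$, where $I = (0,\rho)$ and $0 < \rho \leq \infty$, and fix an integer $N \geq 3$. Suppose that, for some $u_0 \in (0,1)$, $F[-]$ maps the elements of $\mathcal{M}^\rho_{2N-2}(\{1,u_0\})$ with positive entries into \[ \{ (s_0(\mu), \ldots, s_{2N-3}(\mu), s_{2N-2}(\mu)+t) : \mu \text{ an admissible measure on } \mathbb{R}, \ t \geq 0 \}, \] and that $F[-]$ maps the elements of $\mathcal{M}^\rho_2(\{0,1\}) \cup \mathcal{M}^\rho_2(\{u\})$ with positive entries into $\mathcal{M}_2(\mathbb{R})$ for all $u \in (0,1)$. Then $F \in C^{N-3}(I)$, with \[ F^{(k)}(x) \geq 0 \qquad \text{for all } x \in I \quad (0 \leq k \leq N-3), \] and $F^{(N-3)}$ is a convex non-decreasing function on $I$. If, further, it is known that $F \in C^{N-1}(I)$, then $F^{(k)}(x) \geq 0$ for all $x \in I$ and $0 \leq k \leq N-1$. If $F$ is continuous on $I$, then the assumption that $F[-]$ maps the elements of $\mathcal{M}^\rho_2(\{u\})$ (with positive entries) into $\mathcal{M}_2(\mathbb{R})$ for all $u \in (0,1)$ may be omitted.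
   Context: An admissible measure is a non-negative measure $\mu$ on $\mathbb{R}$ possessing moments of all orders; its moments are $s_k(\mu) := \int_{\mathbb{R}} x^k \, d\mu$ ($k \geq 0$), where $s_0(\mu)$ is the total mass. For $K \subset \mathbb{R}$ and $n \geq 0$, $\mathcal{M}_n(K) := \{(s_0(\mu),\dots,s_n(\mu)) : \mu \text{ admissible, supported on } K\}$, and $\mathcal{M}^\rho_n(K)$ is the subset of those truncated moment sequences whose terms all lie in $(-\rho,\rho)$. A function $F$ acts entrywise: $F[(s_0,\dots,s_n)] := (F(s_0),\dots,F(s_n))$. *)

theory Defs
  imports "HOL-Analysis.Analysis"
begin

text \<open>Integrability of \<open>x ^ 0\<close> makes an admissible measure finite.\<close>

definition admissible :: "real measure \<Rightarrow> bool" where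
  "admissible \<mu> \<longleftrightarrow> sets \<mu> = sets borel \<and> (\<forall>k::nat. integrable \<mu> (\<lambda>x. x ^ k))"

text \<open>For closed \<open>K\<close> this says that the topological support of \<open>\<mu>\<close> is contained in \<open>K\<close>.\<close>

definition supported_on :: "real measure \<Rightarrow> real set \<Rightarrow> bool" where
  "supported_on \<mu> K \<longleftrightarrow> (AE x in \<mu>. x \<in> K)"

definition moment :: "real measure \<Rightarrow> nat \<Rightarrow> real" where
  "moment \<mu> k = (\<integral>x. x ^ k \<partial>\<mu>)"

text \<open>Truncated sequences \<open>(s\<^sub>0, \<dots>, s\<^sub>n)\<close> are lists of length \<open>n + 1\<close>, so that the entrywise
  action \<open>F[-]\<close> is \<open>map F\<close>.\<close>

definition moment_seqs :: "nat \<Rightarrow> real set \<Rightarrow> real list set" where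
  "moment_seqs n K = {map (moment \<mu>) [0..<n + 1] | \<mu>. admissible \<mu> \<and> supported_on \<mu> K}"

definition bounded_moment_seqs :: "ereal \<Rightarrow> nat \<Rightarrow> real set \<Rightarrow> real list set" where
  "bounded_moment_seqs \<rho> n K =
     {s \<in> moment_seqs n K. \<forall>x\<in>set s. - \<rho> < ereal x \<and> ereal x < \<rho>}"

definition positive_entries :: "real list \<Rightarrow> bool" where
  "positive_entries s \<longleftrightarrow> (\<forall>x\<in>set s. 0 < x)"

text \<open>The sequences \<open>(s\<^sub>0(\<mu>), \<dots>, s\<^bsub>n-1\<^esub>(\<mu>), s\<^sub>n(\<mu>) + t)\<close> with \<open>t \<ge> 0\<close>.\<close>

definition raised_moment_seqs :: "nat \<Rightarrow> real list set" where
  "raised_moment_seqs n =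
     {map (moment \<mu>) [0..<n] @ [moment \<mu> n + t] | \<mu> t. admissible \<mu> \<and> 0 \<le> t}"

text \<open>The class \<open>C\<^sup>k(S)\<close> for open \<open>S\<close>: there, \<open>(deriv ^^ j) f\<close> depends only on the values of \<open>f\<close> on \<open>S\<close>,
  and is the genuine \<open>j\<close>-th derivative for \<open>j \<le> k\<close>.\<close>

definition Ck_on :: "nat \<Rightarrow> real set \<Rightarrow> (real \<Rightarrow> real) \<Rightarrow> bool" where
  "Ck_on k S f \<longleftrightarrow>
     (\<forall>j<k. \<forall>x\<in>S. (deriv ^^ j) f field_differentiable at x) \<and> continuous_on S ((deriv ^^ k) f)"

end

theory Submission
  imports Defs
begin

text \<open>The proof tests moment sequences against squares of polynomials. If \<open>p\<close> has degree at most \<open>N - 1\<close>,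
  then integrating \<open>p\<^sup>2\<close> against a measure gives a nonnegative number, which is the combination of the
  moments with the coefficients of \<open>p\<^sup>2\<close>; raising the moment of order \<open>2N - 2\<close> only adds a nonnegative
  multiple of the square of the coefficient of \<open>p\<close> at \<open>N - 1\<close>. For the measure with mass \<open>a\<close> at \<open>1\<close> and
  \<open>b\<close> at \<open>u = u\<^sub>0\<close> this turns the hypothesis into the inequalities
  \<open>0 \<le> (\<Sum>m. coeff (p\<^sup>2) m * F (a + b u\<^sup>m))\<close>.

  Take \<open>p = (\<Prod>j<k. X - u\<^sup>j)\<close>, where \<open>k \<le> N - 1\<close>. If \<open>F\<close> is of class \<open>C\<^sup>k\<close>, expand
  \<open>F (a + b u\<^sup>m)\<close> at \<open>a\<close> by Taylor's formula. The term of order \<open>i\<close> contributes a multiple of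
  \<open>p (u\<^sup>i)\<^sup>2\<close>, which vanishes for \<open>i < k\<close> and is positive for \<open>i = k\<close>; dividing by \<open>b\<^sup>k\<close> and
  letting \<open>b\<close> tend to \<open>0\<close> leaves the \<open>k\<close>-th derivative of \<open>F\<close> at \<open>a\<close>, times a positive constant
  (\<open>hankel_nonneg_imp_derivative_nonneg\<close>). This settles the smooth case.

  In general, the measures on \<open>{0, 1}\<close> show that \<open>F\<close> is nonnegative and nondecreasing, and the
  one-point measures give \<open>F (c u)\<^sup>2 \<le> F c * F (c u\<^sup>2)\<close>. A monotone function with this property has no
  jumps, so \<open>F\<close> is continuous in either case of the hypothesis
  (\<open>mono_mult_mid_convex_continuous\<close>). The inequalities above are linear in \<open>F\<close> and invariant under
  translation of \<open>a\<close>, hence are inherited by the averages of \<open>F\<close> over \<open>[x, x + \<delta>]\<close>. Averaging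
  \<open>N\<close> times gives smooth approximants, whose derivatives up to order \<open>N - 1\<close> are nonnegative by the
  smooth case (\<open>smooth_approximation\<close>).

  It remains to let \<open>\<delta>\<close> tend to \<open>0\<close>. A derivative of order between \<open>1\<close> and \<open>N - 2\<close> of an approximant is
  nonnegative and nondecreasing, so it is at most a difference quotient, further to the right, of the
  derivative one order lower. By induction, starting from the convergent values of the approximants, these derivatives are therefore locally bounded, uniformly in
  \<open>\<delta>\<close>. A bound on one derivative makes the derivative below it equi-Lipschitz, and this
  passes pointwise convergence from one order to the next as far as order \<open>N - 3\<close>
  (\<open>pointwise_limit_of_nonneg_derivatives\<close>). At this last order the limit is a pointwise limit of
  convex nondecreasing functions.\<close>

section \<open>Moment sequences and quadratic forms\<close>

lemma atomic_moment_seq: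
  fixes w :: "real \<Rightarrow> real"
  assumes fin: "finite A" and w: "\<And>x. x \<in> A \<Longrightarrow> 0 \<le> w x"
  shows "map (\<lambda>k. \<Sum>x\<in>A. w x * x ^ k) [0..<n + 1] \<in> moment_seqs n A"
proof -
  define \<mu> where "\<mu> = distr (point_measure A w) borel (\<lambda>x. x :: real)"
  have meas: "(\<lambda>x. x) \<in> measurable (point_measure A w) (borel :: real measure)"
    by (simp add: measurable_def sets_point_measure space_point_measure)
  have adm: "admissible \<mu>"
    unfolding admissible_def \<mu>_def
    by (simp add: integrable_distr_eq[OF meas] integrable_point_measure_finite fin)
  have "AE x in \<mu>. x \<in> A"
    unfolding \<mu>_def using fin
    by (subst AE_distr_iff[OF meas]) (auto simp: AE_point_measure intro!: borel_closed finite_imp_closed)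
  then have sup: "supported_on \<mu> A"
    by (simp add: supported_on_def)
  have "moment \<mu> k = (\<Sum>x\<in>A. w x * x ^ k)" for k
    unfolding moment_def \<mu>_def
    by (simp add: integral_distr[OF meas] lebesgue_integral_point_measure_finite fin w)
  with adm sup show ?thesis
    unfolding moment_seqs_def by (auto intro!: exI[of _ \<mu>])
qed

text \<open>The sum is the integral of \<open>p\<^sup>2\<close> plus a nonnegative multiple of the raise. Since the raised entry is the
  one of order \<open>2d\<close>, it is multiplied by \<open>coeff (p\<^sup>2) (2 * d)\<close>, the square of \<open>coeff p d\<close>.\<close>

lemma raised_moment_seq_square_nonneg:
  fixes p :: "real poly"
  assumes s: "map f [0..<2 * d + 1] \<in> raised_moment_seqs (2 * d)" and deg: "degree p \<le> d"
  shows "0 \<le> (\<Sum>m\<le>2 * d. coeff (p\<^sup>2) m * f m)"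
proof -
  obtain \<mu> t where adm: "admissible \<mu>" and t: "0 \<le> t"
    and eq: "map f [0..<2 * d + 1] = map (moment \<mu>) [0..<2 * d] @ [moment \<mu> (2 * d) + t]"
    using s unfolding raised_moment_seqs_def by blast
  have f: "f m = moment \<mu> m + (if m = 2 * d then t else 0)" if "m \<le> 2 * d" for m
  proof -
    have "f m = (map (moment \<mu>) [0..<2 * d] @ [moment \<mu> (2 * d) + t]) ! m"
      using that arg_cong[OF eq, of "\<lambda>l. l ! m"] by (simp del: upt_Suc)
    then show ?thesis
      using that by (auto simp: nth_append)
  qed
  have int: "integrable \<mu> (\<lambda>x. x ^ m)" for m
    using adm by (simp add: admissible_def)
  have deg2: "degree (p\<^sup>2) \<le> 2 * d"
    using degree_power_le[of p 2] deg by linarith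
  have "coeff (p\<^sup>2) (2 * d) = (coeff p d)\<^sup>2"
  proof (cases "degree p = d")
    case True
    have "lead_coeff (p\<^sup>2) = (lead_coeff p)\<^sup>2"
      by (simp add: lead_coeff_power)
    moreover have "degree (p\<^sup>2) = 2 * d"
      using True by (cases "p = 0") (simp_all add: degree_power_eq)
    ultimately show ?thesis
      using True by simp
  next
    case False
    with deg have "degree p < d" by simp
    moreover from this have "degree (p\<^sup>2) < 2 * d"
      using degree_power_le[of p 2] by linarith
    ultimately show ?thesis
      by (simp add: coeff_eq_0)
  qed
  then have lead: "0 \<le> coeff (p\<^sup>2) (2 * d)"
    by simp
  have poly_sum: "poly (p\<^sup>2) x = (\<Sum>m\<le>2 * d. coeff (p\<^sup>2) m * x ^ m)" for x
    unfolding poly_altdef using deg2 by (intro sum.mono_neutral_left) (auto simp: coeff_eq_0)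
  have "(\<Sum>m\<le>2 * d. coeff (p\<^sup>2) m * moment \<mu> m) = (\<integral>x. poly (p\<^sup>2) x \<partial>\<mu>)"
    unfolding poly_sum moment_def using int by simp
  also have "\<dots> \<ge> 0"
    by (intro integral_nonneg_AE) simp
  finally have "0 \<le> (\<Sum>m\<le>2 * d. coeff (p\<^sup>2) m * moment \<mu> m)" .
  moreover have "(\<Sum>m\<le>2 * d. coeff (p\<^sup>2) m * f m)
      = (\<Sum>m\<le>2 * d. coeff (p\<^sup>2) m * moment \<mu> m + (if m = 2 * d then coeff (p\<^sup>2) m * t else 0))"
    by (intro sum.cong) (auto simp: f algebra_simps)
  ultimately show ?thesis
    using lead t by (simp add: sum.distrib)
qed

lemma quadratic_form_discriminant:
  fixes A B C :: real
  assumes "\<And>x y. 0 \<le> A * x\<^sup>2 + 2 * B * x * y + C * y\<^sup>2"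
  shows "0 \<le> A" and "B\<^sup>2 \<le> A * C"
proof -
  show A: "0 \<le> A"
    using assms[of 1 0] by simp
  show "B\<^sup>2 \<le> A * C"
  proof (cases "A = 0")
    case False
    have "0 \<le> A * (A * C - B\<^sup>2)"
      using assms[of B "- A"] by (simp add: power2_eq_square algebra_simps)
    with A False show ?thesis
      by (simp add: zero_le_mult_iff)
  next
    case True
    have "B = 0"
    proof (rule ccontr)
      assume "B \<noteq> 0"
      then show False
        using assms[of "- (C + 1) / (2 * B)" 1] True by (simp add: field_simps)
    qed
    with True show ?thesis by simp
  qed
qed

lemma moment_seq_2_discriminant:
  assumes "[a, b, c] \<in> moment_seqs 2 UNIV"
  shows "0 \<le> a" and "b\<^sup>2 \<le> a * c"
proof -
  define f where "f = (\<lambda>m::nat. [a, b, c] ! m)"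
  have "map f [0..<2 * 1 + 1] = [a, b, c]"
    by (simp add: f_def upt_rec numeral_2_eq_2)
  moreover have "[a, b, c] \<in> raised_moment_seqs 2"
  proof -
    obtain \<mu> where "admissible \<mu>" and "[a, b, c] = map (moment \<mu>) [0..<2 + 1]"
      using assms unfolding moment_seqs_def by auto
    then show ?thesis
      unfolding raised_moment_seqs_def
      by (intro CollectI exI[of _ \<mu>] exI[of _ 0]) (simp add: upt_rec numeral_2_eq_2)
  qed
  ultimately have raised: "map f [0..<2 * 1 + 1] \<in> raised_moment_seqs (2 * 1)"
    by simp
  have "0 \<le> a * x\<^sup>2 + 2 * b * x * y + c * y\<^sup>2" for x y
    using raised_moment_seq_square_nonneg[OF raised, of "[:x, y:]"]
    by (simp add: f_def numeral_2_eq_2 algebra_simps)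
  from quadratic_form_discriminant[OF this] show "0 \<le> a" and "b\<^sup>2 \<le> a * c"
    by auto
qed

section \<open>Hankel forms along a geometric progression\<close>

definition geometric_node_poly :: "real \<Rightarrow> nat \<Rightarrow> real poly" where
  "geometric_node_poly u k = (\<Prod>j<k. [:- (u ^ j), 1:])"

lemma degree_geometric_node_poly [simp]: "degree (geometric_node_poly u k) = k"
  unfolding geometric_node_poly_def by (subst degree_prod_eq_sum_degree) auto

lemma poly_geometric_node_poly: "poly (geometric_node_poly u k) x = (\<Prod>j<k. x - u ^ j)"
  by (simp add: geometric_node_poly_def poly_prod)

lemma poly_geometric_node_poly_eq_0: "i < k \<Longrightarrow> poly (geometric_node_poly u k) (u ^ i) = 0"
  by (auto simp: poly_geometric_node_poly)

lemma poly_geometric_node_poly_neq_0: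
  assumes "0 < u" "u < 1"
  shows "poly (geometric_node_poly u k) (u ^ k) \<noteq> 0"
proof -
  have "u ^ k < u ^ j" if "j < k" for j
    using that assms by (simp add: power_strict_decreasing)
  then show ?thesis
    by (force simp: poly_geometric_node_poly)
qed

lemma geometric_node_poly_square_sum:
  "(\<Sum>m\<le>2 * k. coeff ((geometric_node_poly u k)\<^sup>2) m * x ^ m) = (poly (geometric_node_poly u k) x)\<^sup>2"
proof -
  have "degree ((geometric_node_poly u k)\<^sup>2) \<le> 2 * k"
    using degree_power_le[of "geometric_node_poly u k" 2] by simp
  then have "poly ((geometric_node_poly u k)\<^sup>2) x
      = (\<Sum>m\<le>2 * k. coeff ((geometric_node_poly u k)\<^sup>2) m * x ^ m)"
    unfolding poly_altdef by (intro sum.mono_neutral_left) (auto simp: coeff_eq_0)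
  then show ?thesis
    by simp
qed

text \<open>The sum is the quadratic form of the Hankel matrix with entries \<open>F (a + b * u ^ (i + j))\<close>,
  \<open>0 \<le> i, j \<le> k\<close>, at the coefficient vector of the node polynomial. This one vector is enough to reach the
  derivative of order \<open>k\<close>. The bound \<open>C\<close> is a real number, so that it can be decreased while averaging.\<close>

definition hankel_nonneg :: "real \<Rightarrow> nat \<Rightarrow> real \<Rightarrow> (real \<Rightarrow> real) \<Rightarrow> bool" where
  "hankel_nonneg u k C F \<longleftrightarrow>
     (\<forall>a b. 0 < a \<longrightarrow> 0 < b \<longrightarrow> a + b < C \<longrightarrow>
       0 \<le> (\<Sum>m\<le>2 * k. coeff ((geometric_node_poly u k)\<^sup>2) m * F (a + b * u ^ m)))"

text \<open>The sequence \<open>a + b * u ^ m\<close> consists of the moments of the measure with mass \<open>a\<close> at \<open>1\<close> and \<open>b\<close> at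
  \<open>u\<close>.\<close>

lemma hankel_nonneg_of_moment_transform:
  fixes \<rho> :: ereal
  assumes u: "0 < u" "u < 1"
    and transform: "\<forall>s \<in> bounded_moment_seqs \<rho> (2 * d) {1, u}.
      positive_entries s \<longrightarrow> map F s \<in> raised_moment_seqs (2 * d)"
    and "k \<le> d" and C: "ereal C \<le> \<rho>"
  shows "hankel_nonneg u k C F"
  unfolding hankel_nonneg_def
proof (intro allI impI)
  fix a b :: real assume ab: "0 < a" "0 < b" "a + b < C"
  define w where "w x = (if x = 1 then a else b)" for x :: real
  define s where "s = map (\<lambda>m. a + b * u ^ m) [0..<2 * d + 1]"
  have "(\<lambda>m. \<Sum>x\<in>{1, u}. w x * x ^ m) = (\<lambda>m. a + b * u ^ m)"
    using u by (simp add: w_def)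
  then have "s \<in> moment_seqs (2 * d) {1, u}"
    using atomic_moment_seq[of "{1, u}" w "2 * d"] ab by (simp add: s_def w_def del: upt_Suc)
  moreover have entry: "0 < x \<and> ereal x < \<rho>" if x_in: "x \<in> set s" for x
  proof -
    obtain m where m: "x = a + b * u ^ m" using x_in unfolding s_def set_map by blast
    have "0 < u ^ m" "u ^ m \<le> 1" using u by (auto simp: power_le_one)
    then have "0 < b * u ^ m" "b * u ^ m \<le> b" using ab by (simp_all add: mult_left_le)
    then have "0 < x" "x < C" using ab m by linarith+
    with C show ?thesis by (auto intro: less_le_trans[of "ereal x" "ereal C"])
  qed
  moreover have "- \<rho> < ereal x" if "x \<in> set s" for x
  proof -
    have "0 < \<rho>" using entry[OF that] by (auto intro: less_trans[of 0 "ereal x"])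
    then show ?thesis using entry[OF that] by (cases \<rho>) auto
  qed
  ultimately have "map F s \<in> raised_moment_seqs (2 * d)"
    using transform by (auto simp: bounded_moment_seqs_def positive_entries_def)
  then have "map (\<lambda>m. F (a + b * u ^ m)) [0..<2 * d + 1] \<in> raised_moment_seqs (2 * d)"
    by (simp add: s_def comp_def del: upt_Suc)
  then have "0 \<le> (\<Sum>m\<le>2 * d. coeff ((geometric_node_poly u k)\<^sup>2) m * F (a + b * u ^ m))"
    using \<open>k \<le> d\<close> by (intro raised_moment_seq_square_nonneg) simp_all
  also have "\<dots> = (\<Sum>m\<le>2 * k. coeff ((geometric_node_poly u k)\<^sup>2) m * F (a + b * u ^ m))"
    using \<open>k \<le> d\<close> degree_power_le[of "geometric_node_poly u k" 2]
    by (intro sum.mono_neutral_right) (auto simp: coeff_eq_0)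
  finally show "0 \<le> \<dots>" .
qed

section \<open>Taylor expansion of the Hankel form\<close>

text \<open>Derivatives are carried along as a family \<open>g\<close>, with \<open>g l\<close> the \<open>l\<close>-th derivative of \<open>g 0\<close>: this lets
  approximants and their limits be described by explicit formulas.\<close>

definition deriv_chain :: "nat \<Rightarrow> real set \<Rightarrow> (nat \<Rightarrow> real \<Rightarrow> real) \<Rightarrow> bool" where
  "deriv_chain n S g \<longleftrightarrow> (\<forall>l<n. \<forall>x\<in>S. (g l has_real_derivative g (Suc l) x) (at x))"

text \<open>Taylor's formula with Lagrange remainder. The intermediate point may be an end point of the interval, so that
  the case \<open>k = 0\<close> is included.\<close>

lemma taylor_in_chain:
  assumes chain: "deriv_chain k {0<..<C} g" and "0 < a" "a < y" "y < C"
  shows "\<exists>t. a \<le> t \<and> t \<le> y \<and>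
    g 0 y = (\<Sum>i<k. g i a / fact i * (y - a) ^ i) + g k t / fact k * (y - a) ^ k"
proof (cases "k = 0")
  case True
  with assms show ?thesis by (intro exI[of _ y]) simp
next
  case False
  have "\<exists>t. a < t \<and> t < y \<and>
    g 0 y = (\<Sum>i<k. g i a / fact i * (y - a) ^ i) + g k t / fact k * (y - a) ^ k"
    using False assms by (intro Taylor_up[where a = a]) (auto simp: deriv_chain_def)
  then show ?thesis by (meson less_imp_le)
qed

text \<open>The form annihilates the Taylor polynomial of degree below \<open>k\<close>, because the node polynomial vanishes at
  \<open>u ^ i\<close> for \<open>i < k\<close>. What is left is the remainder, of order \<open>b ^ k\<close>, whose leading coefficient is the
  derivative multiplied by a positive number.\<close>

lemma hankel_nonneg_imp_derivative_nonneg: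
  assumes u: "0 < u" "u < 1"
    and hankel: "hankel_nonneg u k C (g 0)"
    and chain: "deriv_chain k {0<..<C} g"
    and cont: "continuous_on {0<..<C} (g k)"
    and a: "0 < a" "a < C"
  shows "0 \<le> g k a"
proof -
  define q where "q = (geometric_node_poly u k)\<^sup>2"
  have q_sum: "(\<Sum>m\<le>2 * k. coeff q m * x ^ m) = (poly (geometric_node_poly u k) x)\<^sup>2" for x
    unfolding q_def by (rule geometric_node_poly_square_sum)
  define b where "b i = (C - a) / real (i + 2)" for i
  have b_pos: "0 < b i" and b_less: "a + b i < C" for i
  proof -
    show "0 < b i" using a by (simp add: b_def)
    have "b i < C - a" using a unfolding b_def by (simp add: divide_less_eq)
    then show "a + b i < C" by simp
  qed
  have b_lim: "b \<longlonglongrightarrow> 0"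
    unfolding b_def
    by (rule tendsto_divide_0[OF tendsto_const])
      (auto intro!: filterlim_at_top_imp_at_infinity
        filterlim_tendsto_add_at_top[OF tendsto_const filterlim_real_sequentially])
  have u_pow: "0 < u ^ m" "u ^ m \<le> 1" for m
    using u by (auto simp: power_le_one)
  define P where "P i m t \<longleftrightarrow> a \<le> t \<and> t \<le> a + b i * u ^ m \<and>
      g 0 (a + b i * u ^ m)
        = (\<Sum>j<k. g j a / fact j * (b i * u ^ m) ^ j) + g k t / fact k * (b i * u ^ m) ^ k" for i m t
  have "\<exists>t. P i m t" for i m
  proof -
    have "0 < b i * u ^ m" "b i * u ^ m \<le> b i"
      using b_pos[of i] u_pow[of m] by (simp_all add: mult_left_le)
    then have "a < a + b i * u ^ m" "a + b i * u ^ m < C"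
      using b_less[of i] by linarith+
    then show ?thesis
      using taylor_in_chain[OF chain a(1), of "a + b i * u ^ m"] by (simp add: P_def)
  qed
  then obtain t where "\<And>i m. P i m (t i m)" by metis
  then have t: "a \<le> t i m" "t i m \<le> a + b i * u ^ m"
    and taylor: "g 0 (a + b i * u ^ m)
      = (\<Sum>j<k. g j a / fact j * (b i * u ^ m) ^ j) + g k (t i m) / fact k * (b i * u ^ m) ^ k" for i m
    unfolding P_def by blast+
  have remainder_nonneg: "0 \<le> (\<Sum>m\<le>2 * k. coeff q m * (u ^ k) ^ m * g k (t i m))" for i
  proof -
    have "0 \<le> (\<Sum>m\<le>2 * k. coeff q m * g 0 (a + b i * u ^ m))"
      using hankel a b_pos[of i] b_less[of i] by (simp add: hankel_nonneg_def q_def)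
    also have "\<dots> = (\<Sum>m\<le>2 * k. \<Sum>j<k. g j a / fact j * b i ^ j * (coeff q m * (u ^ j) ^ m))
        + (\<Sum>m\<le>2 * k. b i ^ k / fact k * (coeff q m * (u ^ k) ^ m * g k (t i m)))"
      unfolding taylor sum.distrib[symmetric] distrib_left sum_distrib_left
      by (intro sum.cong refl arg_cong2[where f = "(+)"])
        (simp_all add: power_mult_distrib power_mult[symmetric] mult.commute)
    \<comment> \<open>Summation over \<open>m\<close> gives \<open>poly (geometric_node_poly u k) (u ^ j)\<close> squared, with \<open>j < k\<close>.\<close>
    also have "(\<Sum>m\<le>2 * k. \<Sum>j<k. g j a / fact j * b i ^ j * (coeff q m * (u ^ j) ^ m)) = 0"
      by (subst sum.swap, simp only: sum_distrib_left[symmetric] q_sum)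
        (simp add: poly_geometric_node_poly_eq_0)
    finally have "0 \<le> b i ^ k / fact k * (\<Sum>m\<le>2 * k. coeff q m * (u ^ k) ^ m * g k (t i m))"
      by (simp add: sum_distrib_left)
    moreover have "0 < b i ^ k / fact k" using b_pos[of i] by simp
    ultimately show ?thesis by (simp only: zero_le_mult_iff) linarith
  qed
  have "isCont (g k) a"
    using cont a by (simp add: continuous_on_eq_continuous_at)
  moreover have "(\<lambda>i. t i m) \<longlonglongrightarrow> a" for m
  proof (rule tendsto_sandwich[where f = "\<lambda>_. a" and h = "\<lambda>i. a + b i * u ^ m"])
    show "(\<lambda>i. a + b i * u ^ m) \<longlonglongrightarrow> a"
      using tendsto_add[OF tendsto_const tendsto_mult[OF b_lim tendsto_const]] by simp
  qed (use t in auto)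
  ultimately have "(\<lambda>i. g k (t i m)) \<longlonglongrightarrow> g k a" for m
    by (rule isCont_tendsto_compose)
  then have "(\<lambda>i. \<Sum>m\<le>2 * k. coeff q m * (u ^ k) ^ m * g k (t i m))
      \<longlonglongrightarrow> (\<Sum>m\<le>2 * k. coeff q m * (u ^ k) ^ m * g k a)"
    by (intro tendsto_sum tendsto_mult tendsto_const)
  then have "0 \<le> (\<Sum>m\<le>2 * k. coeff q m * (u ^ k) ^ m * g k a)"
    by (rule LIMSEQ_le_const) (use remainder_nonneg in auto)
  then have "0 \<le> (poly (geometric_node_poly u k) (u ^ k))\<^sup>2 * g k a"
    by (simp add: sum_distrib_right[symmetric] q_sum)
  then show ?thesis
    using poly_geometric_node_poly_neq_0[OF u, of k] by (simp add: zero_le_mult_iff)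
qed

section \<open>Smoothing by averages\<close>

text \<open>The function \<open>S\<close> is the mean value of \<open>F\<close> over \<open>[x, x + \<delta>]\<close>, written through a primitive \<open>G\<close> of
  \<open>F\<close>. Averaging only looks to the right, so the interval loses length \<open>\<delta>\<close> at its right end and
  nothing at \<open>0\<close>, where \<open>F\<close> may fail to extend continuously.\<close>

lemma steklov_mean:
  fixes F :: "real \<Rightarrow> real"
  assumes C: "0 < C" and \<delta>: "0 < \<delta>" and cont: "continuous_on {0<..<C + \<delta>} F"
  obtains S where
    "\<And>x. 0 < x \<Longrightarrow> x < C \<Longrightarrow> (S has_real_derivative (F (x + \<delta>) - F x) / \<delta>) (at x)"
    "\<And>x. 0 < x \<Longrightarrow> x < C \<Longrightarrow> \<exists>y. x \<le> y \<and> y \<le> x + \<delta> \<and> S x = F y"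
    "\<And>u k. 0 < u \<Longrightarrow> u < 1 \<Longrightarrow> hankel_nonneg u k (C + \<delta>) F \<Longrightarrow> hankel_nonneg u k C S"
proof -
  have "\<exists>G. \<forall>x. ereal 0 < ereal x \<longrightarrow> ereal x < ereal (C + \<delta>) \<longrightarrow> (G has_vector_derivative F x) (at x)"
    using assms by (intro einterval_antiderivative) (auto simp: continuous_on_eq_continuous_at)
  then obtain G where G: "\<And>x. 0 < x \<Longrightarrow> x < C + \<delta> \<Longrightarrow> (G has_real_derivative F x) (at x)"
    by (auto simp: has_real_derivative_iff_has_vector_derivative)
  define S where "S x = (G (x + \<delta>) - G x) / \<delta>" for x
  show thesis
  proof (rule that[of S])
    fix x assume x: "0 < x" "x < C"
    have "((\<lambda>x. G (x + \<delta>)) has_real_derivative F (x + \<delta>)) (at x)"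
      using G[of "x + \<delta>"] x \<delta> by (simp add: DERIV_shift)
    then show "(S has_real_derivative (F (x + \<delta>) - F x) / \<delta>) (at x)"
      unfolding S_def using G[of x] x \<delta> by (intro DERIV_cdivide DERIV_diff) auto
    have "\<exists>y>x. y < x + \<delta> \<and> G (x + \<delta>) - G x = (x + \<delta> - x) * F y"
      using x \<delta> by (intro MVT2 G) auto
    then obtain y where "x < y" "y < x + \<delta>" "G (x + \<delta>) - G x = \<delta> * F y" by auto
    then show "\<exists>y. x \<le> y \<and> y \<le> x + \<delta> \<and> S x = F y"
      using \<delta> by (intro exI[of _ y]) (simp add: S_def)
  next
    fix u :: real and k assume u: "0 < u" "u < 1" and hankel: "hankel_nonneg u k (C + \<delta>) F"
    define q where "q = (geometric_node_poly u k)\<^sup>2"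
    have u_pow: "0 < u ^ m" "u ^ m \<le> 1" for m
      using u by (auto simp: power_le_one)
    show "hankel_nonneg u k C S"
      unfolding hankel_nonneg_def q_def[symmetric]
    proof (intro allI impI)
      fix a b assume ab: "0 < a" "0 < b" "a + b < C"
      \<comment> \<open>Moving \<open>a\<close> to \<open>a + t\<close> keeps the Hankel inequality, so the primitive of its left-hand side in \<open>t\<close>
        is nondecreasing on \<open>[0, \<delta>]\<close>.\<close>
      define \<Phi> where "\<Phi> t = (\<Sum>m\<le>2 * k. coeff q m * G (a + b * u ^ m + t))" for t
      have "\<Phi> 0 \<le> \<Phi> \<delta>"
      proof (rule DERIV_nonneg_imp_nondecreasing[of 0 \<delta> \<Phi>])
        fix t assume t: "0 \<le> t" "t \<le> \<delta>"
        have pt: "0 < a + b * u ^ m + t" "a + b * u ^ m + t < C + \<delta>" for m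
        proof -
          have "0 < b * u ^ m" "b * u ^ m \<le> b"
            using ab u_pow[of m] by (simp_all add: mult_left_le)
          then show "0 < a + b * u ^ m + t" "a + b * u ^ m + t < C + \<delta>"
            using ab t by linarith+
        qed
        have "((\<lambda>t. G (a + b * u ^ m + t)) has_real_derivative F (a + b * u ^ m + t)) (at t)" for m
          using iffD1[OF DERIV_shift, of G _ t "a + b * u ^ m"] G[OF pt, of m]
          by (simp add: add.commute)
        then have "(\<Phi> has_real_derivative (\<Sum>m\<le>2 * k. coeff q m * F (a + b * u ^ m + t))) (at t)"
          unfolding \<Phi>_def by (intro DERIV_sum DERIV_cmult)
        moreover have "0 \<le> (\<Sum>m\<le>2 * k. coeff q m * F ((a + t) + b * u ^ m))"
          using hankel ab t unfolding hankel_nonneg_def q_def by auto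
        then have "0 \<le> (\<Sum>m\<le>2 * k. coeff q m * F (a + b * u ^ m + t))"
          by (simp add: ac_simps)
        ultimately show "\<exists>y. (\<Phi> has_real_derivative y) (at t) \<and> 0 \<le> y" by blast
      qed (use \<delta> in simp)
      then have "0 \<le> (\<Phi> \<delta> - \<Phi> 0) / \<delta>" using \<delta> by simp
      also have "\<dots> = (\<Sum>m\<le>2 * k. coeff q m * S (a + b * u ^ m))"
        by (simp add: \<Phi>_def S_def sum_subtractf[symmetric] sum_divide_distrib right_diff_distrib)
      finally show "0 \<le> (\<Sum>m\<le>2 * k. coeff q m * S (a + b * u ^ m))" .
    qed
  qed
qed

text \<open>Averaging \<open>j\<close> times gives \<open>j\<close> derivatives: the derivative of a mean is a difference quotient, and so
  are the higher ones. That \<open>g 0 x\<close> is a value of \<open>F\<close> close to \<open>x\<close> is the mean value theorem, and is all that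
  convergence to \<open>F\<close> requires.\<close>

lemma smooth_approximation:
  fixes F :: "real \<Rightarrow> real"
  assumes "0 < C" and "0 < \<delta>" and "continuous_on {0<..<C + real j * \<delta>} F"
  shows "\<exists>g. deriv_chain j {0<..<C} g \<and> continuous_on {0<..<C} (g 0)
    \<and> (\<forall>x\<in>{0<..<C}. \<exists>y. x \<le> y \<and> y \<le> x + real j * \<delta> \<and> g 0 x = F y)
    \<and> (\<forall>u k. 0 < u \<longrightarrow> u < 1 \<longrightarrow> hankel_nonneg u k (C + real j * \<delta>) F \<longrightarrow> hankel_nonneg u k C (g 0))"
  using assms
proof (induction j arbitrary: C)
  case 0
  then show ?case
    by (intro exI[of _ "\<lambda>_. F"]) (auto simp: deriv_chain_def)
next
  case (Suc j)
  have shift: "C + real (Suc j) * \<delta> = (C + \<delta>) + real j * \<delta>"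
    by (simp add: algebra_simps)
  obtain g where chain: "deriv_chain j {0<..<C + \<delta>} g"
    and cont: "continuous_on {0<..<C + \<delta>} (g 0)"
    and near: "\<And>x. x \<in> {0<..<C + \<delta>} \<Longrightarrow> \<exists>y. x \<le> y \<and> y \<le> x + real j * \<delta> \<and> g 0 x = F y"
    and hankel: "\<And>u k. 0 < u \<Longrightarrow> u < 1 \<Longrightarrow> hankel_nonneg u k (C + \<delta> + real j * \<delta>) F
      \<Longrightarrow> hankel_nonneg u k (C + \<delta>) (g 0)"
    using Suc.IH[of "C + \<delta>"] Suc.prems unfolding shift by auto
  obtain S where S: "\<And>x. 0 < x \<Longrightarrow> x < C \<Longrightarrow> (S has_real_derivative (g 0 (x + \<delta>) - g 0 x) / \<delta>) (at x)"
    and S_near: "\<And>x. 0 < x \<Longrightarrow> x < C \<Longrightarrow> \<exists>y. x \<le> y \<and> y \<le> x + \<delta> \<and> S x = g 0 y"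
    and S_hankel: "\<And>u k. 0 < u \<Longrightarrow> u < 1 \<Longrightarrow> hankel_nonneg u k (C + \<delta>) (g 0) \<Longrightarrow> hankel_nonneg u k C S"
    using steklov_mean[OF Suc.prems(1,2) cont] by blast
  define h where "h l x = (case l of 0 \<Rightarrow> S x | Suc i \<Rightarrow> (g i (x + \<delta>) - g i x) / \<delta>)" for l x
  have h_simps: "h 0 = S" "h (Suc i) = (\<lambda>x. (g i (x + \<delta>) - g i x) / \<delta>)" for i
    by (auto simp: h_def)
  have "deriv_chain (Suc j) {0<..<C} h"
    unfolding deriv_chain_def
  proof (intro allI impI ballI)
    fix l x assume l: "l < Suc j" and x: "x \<in> {0<..<C}"
    show "(h l has_real_derivative h (Suc l) x) (at x)"
    proof (cases l)
      case 0
      then show ?thesis using S x by (simp add: h_simps)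
    next
      case (Suc i)
      have "(g i has_real_derivative g (Suc i) x) (at x)"
        using chain l x Suc \<open>0 < \<delta>\<close> by (simp add: deriv_chain_def)
      moreover have "((\<lambda>x. g i (x + \<delta>)) has_real_derivative g (Suc i) (x + \<delta>)) (at x)"
        using chain l x Suc \<open>0 < \<delta>\<close> by (simp add: deriv_chain_def DERIV_shift[symmetric])
      ultimately show ?thesis
        unfolding Suc h_simps by (intro DERIV_cdivide DERIV_diff)
    qed
  qed
  moreover have "continuous_on {0<..<C} (h 0)"
    unfolding h_simps using S by (intro continuous_at_imp_continuous_on) (metis DERIV_isCont greaterThanLessThan_iff)
  moreover have "\<exists>y. x \<le> y \<and> y \<le> x + real (Suc j) * \<delta> \<and> h 0 x = F y" if "x \<in> {0<..<C}" for x
  proof -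
    have x: "0 < x" "x < C" using that by auto
    obtain z where z: "x \<le> z" "z \<le> x + \<delta>" "S x = g 0 z"
      using S_near[OF x] by auto
    then have "z \<in> {0<..<C + \<delta>}" using x by auto
    then obtain y where "z \<le> y" "y \<le> z + real j * \<delta>" "g 0 z = F y"
      using near by blast
    with z show ?thesis
      by (intro exI[of _ y]) (simp add: h_simps algebra_simps)
  qed
  ultimately show ?case
    using hankel S_hankel unfolding shift by (intro exI[of _ h]) (simp add: h_simps)
qed

section \<open>Limits of functions with nonnegative derivatives\<close>

text \<open>The common Lipschitz bound makes difference quotients approximate derivatives uniformly in \<open>i\<close>. So the
  derivatives at \<open>x\<close> inherit the Cauchy property from the values at two points, and the limit inherits the
  first-order expansion.\<close>

lemma derivative_of_pointwise_limit:
  fixes f f' :: "nat \<Rightarrow> real \<Rightarrow> real"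
  assumes r: "0 < r"
    and der: "\<And>i y. \<bar>y - x\<bar> \<le> r \<Longrightarrow> (f i has_real_derivative f' i y) (at y)"
    and lip: "\<And>i y. \<bar>y - x\<bar> \<le> r \<Longrightarrow> \<bar>f' i y - f' i x\<bar> \<le> M * \<bar>y - x\<bar>"
    and lim: "\<And>y. \<bar>y - x\<bar> \<le> r \<Longrightarrow> (\<lambda>i. f i y) \<longlonglongrightarrow> \<phi> y"
  obtains L where "(\<lambda>i. f' i x) \<longlonglongrightarrow> L" and "(\<phi> has_real_derivative L) (at x)"
proof -
  have M: "0 \<le> M"
  proof -
    have "0 \<le> M * r" using lip[of "x + r" 0] r by (smt (verit))
    then show ?thesis using r by (simp add: zero_le_mult_iff)
  qed
  have taylor: "\<bar>f i (x + h) - f i x - h * f' i x\<bar> \<le> M * h\<^sup>2" if h: "\<bar>h\<bar> \<le> r" for i h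
  proof -
    have "\<exists>\<xi>. \<bar>\<xi> - x\<bar> \<le> \<bar>h\<bar> \<and> f i (x + h) - f i x = h * f' i \<xi>"
    proof (cases h "0 :: real" rule: linorder_cases)
      case less
      then have "\<exists>z>x + h. z < x \<and> f i x - f i (x + h) = (x - (x + h)) * f' i z"
        using h by (intro MVT2 der) auto
      then obtain z where "x + h < z" "z < x" "f i x - f i (x + h) = - h * f' i z" by auto
      then show ?thesis by (intro exI[of _ z]) auto
    next
      case equal
      then show ?thesis by auto
    next
      case greater
      then have "\<exists>z>x. z < x + h \<and> f i (x + h) - f i x = (x + h - x) * f' i z"
        using h by (intro MVT2 der) auto
      then obtain z where "x < z" "z < x + h" "f i (x + h) - f i x = h * f' i z" by auto
      then show ?thesis by (intro exI[of _ z]) auto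
    qed
    then obtain \<xi> where \<xi>: "\<bar>\<xi> - x\<bar> \<le> \<bar>h\<bar>" "f i (x + h) - f i x = h * f' i \<xi>" by blast
    have "\<bar>f' i \<xi> - f' i x\<bar> \<le> M * \<bar>h\<bar>"
      using lip[of \<xi> i] \<xi>(1) h M mult_left_mono[OF \<xi>(1) M] by linarith
    then have "\<bar>h\<bar> * \<bar>f' i \<xi> - f' i x\<bar> \<le> \<bar>h\<bar> * (M * \<bar>h\<bar>)"
      by (intro mult_left_mono) auto
    also have "\<dots> = M * h\<^sup>2"
      by (simp add: power2_eq_square abs_mult[symmetric] algebra_simps)
    finally show ?thesis
      unfolding \<xi>(2) by (simp add: abs_mult[symmetric] right_diff_distrib)
  qed
  have "Cauchy (\<lambda>i. f' i x)"
  proof (rule CauchyI)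
    fix e :: real assume e: "0 < e"
    \<comment> \<open>The step must be so small that the error \<open>M * h\<close> of a difference quotient is below \<open>e / 4\<close>.\<close>
    define h where "h = min r (e / (4 * (M + 1)))"
    have h: "0 < h" "h \<le> r" using e r M by (auto simp: h_def)
    have "h \<le> e / (4 * (M + 1))" by (simp add: h_def)
    then have "h * (4 * (M + 1)) \<le> e" using M by (simp add: pos_le_divide_eq)
    then have Mh: "4 * (M * h) < e" using h by (simp add: algebra_simps)
    define D where "D i = (f i (x + h) - f i x) / h" for i
    have near: "\<bar>D i - f' i x\<bar> \<le> M * h" for i
    proof -
      have "h * \<bar>D i - f' i x\<bar> = \<bar>f i (x + h) - f i x - h * f' i x\<bar>"
      proof -
        have "h * \<bar>D i - f' i x\<bar> = \<bar>h * (D i - f' i x)\<bar>" using h by (simp add: abs_mult)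
        also have "h * (D i - f' i x) = f i (x + h) - f i x - h * f' i x"
          using h by (simp add: D_def field_simps)
        finally show ?thesis .
      qed
      also have "\<dots> \<le> M * h\<^sup>2" using taylor[of h i] h by simp
      finally have "h * \<bar>D i - f' i x\<bar> \<le> h * (M * h)"
        by (simp add: power2_eq_square algebra_simps)
      then show ?thesis using h by simp
    qed
    have "D \<longlonglongrightarrow> (\<phi> (x + h) - \<phi> x) / h"
      unfolding D_def using h r by (intro tendsto_divide tendsto_diff lim tendsto_const) auto
    then have "Cauchy D" by (rule LIMSEQ_imp_Cauchy)
    then obtain K where K: "\<And>m n. K \<le> m \<Longrightarrow> K \<le> n \<Longrightarrow> \<bar>D m - D n\<bar> < e / 2"
      using e CauchyD[of D "e / 2"] by auto
    have "\<bar>f' m x - f' n x\<bar> < e" if "K \<le> m" "K \<le> n" for m n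
      using K[OF that] near[of m] near[of n] Mh by linarith
    then show "\<exists>K. \<forall>m\<ge>K. \<forall>n\<ge>K. norm (f' m x - f' n x) < e"
      by auto
  qed
  then obtain L where L: "(\<lambda>i. f' i x) \<longlonglongrightarrow> L"
    using Cauchy_convergent_iff convergent_def by blast
  have bound: "\<bar>\<phi> (x + h) - \<phi> x - h * L\<bar> \<le> M * h\<^sup>2" if h: "\<bar>h\<bar> \<le> r" for h
  proof (rule LIMSEQ_le_const2)
    show "(\<lambda>i. \<bar>f i (x + h) - f i x - h * f' i x\<bar>) \<longlonglongrightarrow> \<bar>\<phi> (x + h) - \<phi> x - h * L\<bar>"
      using h r by (intro tendsto_rabs tendsto_diff tendsto_mult lim tendsto_const L) auto
  qed (use taylor[OF h] in auto)
  have "(\<lambda>h. (\<phi> (x + h) - \<phi> x) / h) \<midarrow>0\<rightarrow> L"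
  proof (rule LIM_zero_cancel, rule tendsto_0_le[where K = 1])
    show "(\<lambda>h. M * h) \<midarrow>0\<rightarrow> 0" by (intro tendsto_mult_right_zero tendsto_ident_at)
    have "norm ((\<phi> (x + h) - \<phi> x) / h - L) \<le> norm (M * h) * 1" if "h \<noteq> 0" "\<bar>h\<bar> \<le> r" for h
    proof -
      have "\<bar>h\<bar> * \<bar>(\<phi> (x + h) - \<phi> x) / h - L\<bar> = \<bar>\<phi> (x + h) - \<phi> x - h * L\<bar>"
      proof -
        have "\<bar>h\<bar> * \<bar>(\<phi> (x + h) - \<phi> x) / h - L\<bar> = \<bar>h * ((\<phi> (x + h) - \<phi> x) / h - L)\<bar>"
          by (simp add: abs_mult)
        also have "h * ((\<phi> (x + h) - \<phi> x) / h - L) = \<phi> (x + h) - \<phi> x - h * L"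
          using that by (simp add: field_simps)
        finally show ?thesis .
      qed
      also have "\<dots> \<le> \<bar>h\<bar> * (M * \<bar>h\<bar>)"
        using bound[OF that(2)] by (simp add: power2_eq_square abs_mult[symmetric] algebra_simps)
      finally show ?thesis using that M by (simp add: abs_mult)
    qed
    moreover have "\<forall>\<^sub>F h in at 0. h \<noteq> 0 \<and> \<bar>h\<bar> \<le> r"
      unfolding eventually_at using r by (intro exI[of _ r]) (auto simp: dist_real_def)
    ultimately show "\<forall>\<^sub>F h in at 0. norm ((\<phi> (x + h) - \<phi> x) / h - L) \<le> norm (M * h) * 1"
      by (auto elim: eventually_mono)
  qed
  then have "(\<phi> has_real_derivative L) (at x)" by (simp add: DERIV_def)
  with L show thesis by (rule that)
qed

lemma deriv_chain_nonneg_mono: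
  assumes chain: "deriv_chain n {0<..<C} g" and "l < n"
    and nonneg: "\<And>x. x \<in> {0<..<C} \<Longrightarrow> 0 \<le> g (Suc l) x"
    and "0 < x" "x \<le> y" "y < C"
  shows "g l x \<le> g l y"
proof (rule DERIV_nonneg_imp_nondecreasing[OF \<open>x \<le> y\<close>])
  fix z assume "x \<le> z" "z \<le> y"
  then have z: "z \<in> {0<..<C}" using assms by auto
  then show "\<exists>d. (g l has_real_derivative d) (at z) \<and> 0 \<le> d"
    using chain \<open>l < n\<close> nonneg[OF z] z unfolding deriv_chain_def by blast
qed

text \<open>Each step compares the nondecreasing function \<open>g i (Suc l)\<close> with a difference quotient of \<open>g i l\<close> between
  \<open>x\<close> and a point farther right.\<close>

lemma nonneg_derivatives_locally_bounded:
  fixes g :: "nat \<Rightarrow> nat \<Rightarrow> real \<Rightarrow> real"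
  assumes chain: "\<And>i. deriv_chain n {0<..<C} (g i)"
    and nonneg: "\<And>i l x. l \<le> n \<Longrightarrow> x \<in> {0<..<C} \<Longrightarrow> 0 \<le> g i l x"
    and bdd: "\<And>x. x \<in> {0<..<C} \<Longrightarrow> \<exists>M. \<forall>i. g i 0 x \<le> M"
    and "l < n" "x \<in> {0<..<C}"
  shows "\<exists>M. \<forall>i. \<forall>y\<in>{0<..x}. g i l y \<le> M"
  using \<open>l < n\<close> \<open>x \<in> {0<..<C}\<close>
proof (induction l arbitrary: x)
  case 0
  obtain M where "\<And>i. g i 0 x \<le> M" using bdd[OF 0(2)] by blast
  moreover have "g i 0 y \<le> g i 0 x" if "y \<in> {0<..x}" for i y
    using 0 that nonneg by (intro deriv_chain_nonneg_mono[OF chain]) auto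
  ultimately show ?case by (meson order_trans)
next
  case (Suc l)
  define z where "z = (x + C) / 2"
  have z: "x < z" "z < C" "0 < z" using Suc.prems by (auto simp: z_def)
  obtain M where M: "\<And>i y. y \<in> {0<..z} \<Longrightarrow> g i l y \<le> M"
    using Suc.IH[of z] Suc.prems z by (metis Suc_lessD greaterThanLessThan_iff)
  have "g i (Suc l) y \<le> M / (z - x)" if y: "y \<in> {0<..x}" for i y
  proof -
    have "\<exists>w>x. w < z \<and> g i l z - g i l x = (z - x) * g i (Suc l) w"
      using z Suc.prems chain[of i] by (intro MVT2) (auto simp: deriv_chain_def)
    then obtain w where w: "x < w" "w < z" "g i l z - g i l x = (z - x) * g i (Suc l) w" by blast
    have "g i (Suc l) y \<le> g i (Suc l) w"
      using Suc.prems y w z nonneg by (intro deriv_chain_nonneg_mono[OF chain]) auto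
    then have "(z - x) * g i (Suc l) y \<le> g i l z - g i l x"
      using z by (simp add: w(3))
    also have "\<dots> \<le> M"
      using M[of z i] nonneg[of l x i] Suc.prems z by auto
    finally show ?thesis using z by (simp add: field_simps)
  qed
  then show ?case by blast
qed

text \<open>Two orders are lost: convergence of the derivatives of order \<open>l + 1\<close> needs those of order \<open>l + 2\<close> to be
  locally bounded, and these are bounded because they are nondecreasing, that is, because the derivatives of
  order \<open>l + 3\<close> are nonnegative.\<close>

lemma pointwise_limit_of_nonneg_derivatives:
  fixes g :: "nat \<Rightarrow> nat \<Rightarrow> real \<Rightarrow> real"
  assumes chain: "\<And>i. deriv_chain (n + 2) {0<..<C} (g i)"
    and nonneg: "\<And>i l x. l \<le> n + 2 \<Longrightarrow> x \<in> {0<..<C} \<Longrightarrow> 0 \<le> g i l x"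
    and lim: "\<And>x. x \<in> {0<..<C} \<Longrightarrow> (\<lambda>i. g i 0 x) \<longlonglongrightarrow> f x"
  obtains h where "h 0 = f" and "deriv_chain n {0<..<C} h"
    and "\<And>l x. l \<le> n \<Longrightarrow> x \<in> {0<..<C} \<Longrightarrow> (\<lambda>i. g i l x) \<longlonglongrightarrow> h l x"
proof -
  have bdd: "\<exists>M. \<forall>i. g i 0 x \<le> M" if "x \<in> {0<..<C}" for x
  proof -
    have "Bseq (\<lambda>i. g i 0 x)" using lim[OF that] convergent_imp_Bseq convergentI by blast
    then obtain K where "\<And>i. \<bar>g i 0 x\<bar> \<le> K" by (auto simp: Bseq_def)
    then show ?thesis by (meson abs_le_D1)
  qed
  define h where "h l x = (if l = 0 then f x else lim (\<lambda>i. g i l x))" for l x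
  have step: "(\<lambda>i. g i (Suc l) x) \<longlonglongrightarrow> h (Suc l) x \<and> (h l has_real_derivative h (Suc l) x) (at x)"
    if l: "l < n" and x: "x \<in> {0<..<C}"
      and conv: "\<And>y. y \<in> {0<..<C} \<Longrightarrow> (\<lambda>i. g i l y) \<longlonglongrightarrow> h l y" for l x
  proof -
    have l2: "Suc (Suc l) < n + 2" using l by simp
    define r where "r = min x (C - x) / 2"
    have r: "0 < r" "r < x" "x + r < C" using x by (auto simp: r_def min_def field_simps)
    then have xr: "x + r \<in> {0<..<C}" by simp
    obtain M where M: "\<And>i y. y \<in> {0<..x + r} \<Longrightarrow> g i (Suc (Suc l)) y \<le> M"
      using nonneg_derivatives_locally_bounded[OF chain nonneg bdd l2 xr] by blast
    have inside: "y \<in> {0<..<C}" "y \<in> {0<..x + r}" if "\<bar>y - x\<bar> \<le> r" for y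
      using that r by auto
    have der: "(g i m has_real_derivative g i (Suc m) y) (at y)"
      if "m \<le> Suc l" "\<bar>y - x\<bar> \<le> r" for i m y
      using chain[of i] l that inside[of y] by (auto simp: deriv_chain_def)
    have lip: "\<bar>g i (Suc l) y - g i (Suc l) x\<bar> \<le> M * \<bar>y - x\<bar>" if y: "\<bar>y - x\<bar> \<le> r" for i y
    proof -
      have "\<exists>w. \<bar>w - x\<bar> \<le> r \<and> \<bar>g i (Suc l) y - g i (Suc l) x\<bar> = \<bar>y - x\<bar> * \<bar>g i (Suc (Suc l)) w\<bar>"
      proof (cases y x rule: linorder_cases)
        case less
        have "\<exists>w>y. w < x \<and> g i (Suc l) x - g i (Suc l) y = (x - y) * g i (Suc (Suc l)) w"
          using less y by (intro MVT2 der) auto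
        then obtain w where w: "y < w" "w < x"
            "g i (Suc l) x - g i (Suc l) y = (x - y) * g i (Suc (Suc l)) w" by blast
        have "\<bar>g i (Suc l) y - g i (Suc l) x\<bar> = \<bar>g i (Suc l) x - g i (Suc l) y\<bar>" by simp
        also have "\<dots> = \<bar>y - x\<bar> * \<bar>g i (Suc (Suc l)) w\<bar>"
          unfolding w(3) by (simp add: abs_mult abs_minus_commute)
        finally show ?thesis using w y by (intro exI[of _ w]) auto
      next
        case equal
        then show ?thesis using r by (intro exI[of _ x]) auto
      next
        case greater
        have "\<exists>w>x. w < y \<and> g i (Suc l) y - g i (Suc l) x = (y - x) * g i (Suc (Suc l)) w"
          using greater y by (intro MVT2 der) auto
        then obtain w where w: "x < w" "w < y"
            "g i (Suc l) y - g i (Suc l) x = (y - x) * g i (Suc (Suc l)) w" by blast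
        then show ?thesis using y by (intro exI[of _ w]) (auto simp: abs_mult)
      qed
      then obtain w where w: "\<bar>w - x\<bar> \<le> r"
        "\<bar>g i (Suc l) y - g i (Suc l) x\<bar> = \<bar>y - x\<bar> * \<bar>g i (Suc (Suc l)) w\<bar>" by blast
      have "\<bar>g i (Suc (Suc l)) w\<bar> \<le> M"
        using M[OF inside(2)[OF w(1)]] nonneg[OF _ inside(1)[OF w(1)], of "Suc (Suc l)" i] l by auto
      then show ?thesis
        unfolding w(2) by (subst mult.commute) (simp add: mult_right_mono)
    qed
    obtain L where L: "(\<lambda>i. g i (Suc l) x) \<longlonglongrightarrow> L" "(h l has_real_derivative L) (at x)"
      using derivative_of_pointwise_limit[of r x "\<lambda>i. g i l" "\<lambda>i. g i (Suc l)" M "h l"]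
        r(1) der lip conv inside(1) by (metis le_SucI order_refl)
    moreover have "h (Suc l) x = L" using limI[OF L(1)] by (simp add: h_def)
    ultimately show ?thesis by simp
  qed
  have conv: "(\<lambda>i. g i l x) \<longlonglongrightarrow> h l x" if "l \<le> n" "x \<in> {0<..<C}" for l x
    using that
  proof (induction l arbitrary: x)
    case 0
    then show ?case using lim by (simp add: h_def)
  next
    case (Suc l)
    then show ?case using step[of l x] by simp
  qed
  show thesis
  proof (rule that[of h])
    show "h 0 = f" by (simp add: h_def fun_eq_iff)
    show "deriv_chain n {0<..<C} h"
      unfolding deriv_chain_def using step conv by auto
  qed (use conv in auto)
qed

lemma iterated_deriv_eq_chain:
  assumes chain: "deriv_chain n S h" and "open S" and "l \<le> n" "x \<in> S"
  shows "(deriv ^^ l) (h 0) x = h l x"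
  using \<open>l \<le> n\<close> \<open>x \<in> S\<close>
proof (induction l arbitrary: x)
  case 0
  then show ?case by simp
next
  case (Suc l)
  have "(h l has_real_derivative h (Suc l) x) (at x)"
    using chain Suc.prems by (simp add: deriv_chain_def)
  then have "((deriv ^^ l) (h 0) has_real_derivative h (Suc l) x) (at x)"
    by (rule has_field_derivative_transform_within_open[OF _ \<open>open S\<close>]) (use Suc in auto)
  then show ?case by (simp add: DERIV_imp_deriv)
qed

text \<open>The approximants are \<open>n + 3\<close> times differentiable, one order more than the nonnegative derivatives that are
  wanted, so that the derivative of order \<open>n + 2\<close> is continuous as well. Their right margin
  \<open>(n + 3) * \<delta> i\<close> is \<open>(C - c) / (i + 1)\<close>, which tends to \<open>0\<close> and is at most \<open>C - c\<close>.\<close>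

lemma hankel_nonneg_imp_regular:
  fixes F :: "real \<Rightarrow> real"
  assumes u: "0 < u" "u < 1" and cC: "0 < c" "c < C"
    and cont: "continuous_on {0<..<C} F"
    and hankel: "\<And>k. k \<le> n + 2 \<Longrightarrow> hankel_nonneg u k C F"
  shows "\<And>l x. l < n \<Longrightarrow> x \<in> {0<..<c} \<Longrightarrow> (deriv ^^ l) F field_differentiable at x"
    and "\<And>l x. l \<le> n \<Longrightarrow> x \<in> {0<..<c} \<Longrightarrow> 0 \<le> (deriv ^^ l) F x"
    and "convex_on {0<..<c} ((deriv ^^ n) F)"
    and "mono_on {0<..<c} ((deriv ^^ n) F)"
proof -
  define \<delta> where "\<delta> i = (C - c) / (real (n + 3) * real (Suc i))" for i
  have \<delta>_pos: "0 < \<delta> i" for i using cC by (simp add: \<delta>_def)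
  have width: "real (n + 3) * \<delta> i = (C - c) / real (Suc i)" for i
    unfolding \<delta>_def by (simp del: of_nat_add of_nat_Suc)
  have width_le: "c + real (n + 3) * \<delta> i \<le> C" for i
  proof -
    have "(C - c) / real (Suc i) \<le> (C - c) / 1" using cC by (intro divide_left_mono) auto
    then show ?thesis unfolding width by simp
  qed
  have hankel': "hankel_nonneg u k (c + real (n + 3) * \<delta> i) F" if "k \<le> n + 2" for k i
    using hankel[OF that] width_le[of i] unfolding hankel_nonneg_def by (meson less_le_trans)
  have cont': "continuous_on {0<..<c + real (n + 3) * \<delta> i} F" for i
    using cont width_le[of i] by (rule_tac continuous_on_subset) auto
  have "\<exists>g. deriv_chain (n + 3) {0<..<c} g
    \<and> (\<forall>x\<in>{0<..<c}. \<exists>y. x \<le> y \<and> y \<le> x + real (n + 3) * \<delta> i \<and> g 0 x = F y)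
    \<and> (\<forall>k\<le>n + 2. hankel_nonneg u k c (g 0))" for i
    using smooth_approximation[OF cC(1) \<delta>_pos cont'] hankel' u by meson
  then obtain g where chain: "\<And>i. deriv_chain (n + 3) {0<..<c} (g i)"
    and near: "\<And>i x. x \<in> {0<..<c} \<Longrightarrow> \<exists>y. x \<le> y \<and> y \<le> x + real (n + 3) * \<delta> i \<and> g i 0 x = F y"
    and g_hankel: "\<And>i k. k \<le> n + 2 \<Longrightarrow> hankel_nonneg u k c (g i 0)"
    by metis
  have sub: "deriv_chain m {0<..<c} (g i)" if "m \<le> n + 3" for m i
    using chain[of i] that by (auto simp: deriv_chain_def)
  have nonneg: "0 \<le> g i k x" if "k \<le> n + 2" "x \<in> {0<..<c}" for i k x
  proof (rule hankel_nonneg_imp_derivative_nonneg[where g = "g i", OF u g_hankel[OF that(1)]])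
    show "continuous_on {0<..<c} (g i k)"
    proof (intro continuous_at_imp_continuous_on ballI)
      fix y assume "y \<in> {0<..<c}"
      then have "(g i k has_real_derivative g i (Suc k) y) (at y)"
        using chain[of i] that(1) by (simp add: deriv_chain_def)
      then show "isCont (g i k) y" by (rule DERIV_isCont)
    qed
  qed (use sub that in auto)
  have lim: "(\<lambda>i. g i 0 x) \<longlonglongrightarrow> F x" if x: "x \<in> {0<..<c}" for x
  proof -
    have "\<exists>y. x \<le> y \<and> y \<le> x + (C - c) / real (Suc i) \<and> g i 0 x = F y" for i
      using near[OF x, of i] unfolding width .
    then obtain y where y: "\<And>i. x \<le> y i" "\<And>i. y i \<le> x + (C - c) / real (Suc i)" "\<And>i. g i 0 x = F (y i)"
      by metis
    have "(\<lambda>i. x + (C - c) / real (Suc i)) \<longlonglongrightarrow> x + 0"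
      by (rule tendsto_add[OF tendsto_const LIMSEQ_Suc[OF lim_const_over_n]])
    then have upper: "(\<lambda>i. x + (C - c) / real (Suc i)) \<longlonglongrightarrow> x" by (simp only: add_0_right)
    have "y \<longlonglongrightarrow> x"
      by (rule tendsto_sandwich[OF always_eventually always_eventually tendsto_const upper])
        (intro allI y)+
    moreover have "isCont F x"
      using cont x cC by (simp add: continuous_on_eq_continuous_at)
    ultimately show ?thesis
      unfolding y(3) by (rule isCont_tendsto_compose[rotated])
  qed
  have sub2: "deriv_chain (n + 2) {0<..<c} (g i)" for i
    using sub by simp
  obtain h where h0: "h 0 = F" and h_chain: "deriv_chain n {0<..<c} h"
    and h_lim: "\<And>l x. l \<le> n \<Longrightarrow> x \<in> {0<..<c} \<Longrightarrow> (\<lambda>i. g i l x) \<longlonglongrightarrow> h l x"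
    using pointwise_limit_of_nonneg_derivatives[OF sub2 nonneg lim] by blast
  have deriv_lim: "(\<lambda>i. g i l x) \<longlonglongrightarrow> (deriv ^^ l) F x" if "l \<le> n" "x \<in> {0<..<c}" for l x
    using iterated_deriv_eq_chain[OF h_chain open_greaterThanLessThan that] h_lim[OF that] by (simp add: h0)
  show "(deriv ^^ l) F field_differentiable at x" if l: "l < n" and x: "x \<in> {0<..<c}" for l x
  proof -
    have "(h l has_real_derivative h (Suc l) x) (at x)"
      using h_chain l x by (simp add: deriv_chain_def)
    moreover have "h l y = (deriv ^^ l) F y" if "y \<in> {0<..<c}" for y
      using iterated_deriv_eq_chain[OF h_chain open_greaterThanLessThan _ that, of l] l by (simp add: h0)
    ultimately have "((deriv ^^ l) F has_real_derivative h (Suc l) x) (at x)"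
      by (rule has_field_derivative_transform_within_open[OF _ open_greaterThanLessThan x])
    then show ?thesis by (auto simp: field_differentiable_def)
  qed
  show "0 \<le> (deriv ^^ l) F x" if "l \<le> n" "x \<in> {0<..<c}" for l x
    using deriv_lim[OF that] by (rule LIMSEQ_le_const) (use nonneg that in auto)
  show "convex_on {0<..<c} ((deriv ^^ n) F)"
  proof (rule convex_onI)
    fix t x y :: real assume t: "0 < t" "t < 1" and xy: "x \<in> {0<..<c}" "y \<in> {0<..<c}"
    have cvx: "convex_on {0<..<c} (g i n)" for i
      using chain[of i] nonneg
      by (intro f''_ge0_imp_convex[where f' = "g i (Suc n)" and f'' = "g i (Suc (Suc n))"])
        (auto simp: deriv_chain_def)
    have in_c: "(1 - t) *\<^sub>R x + t *\<^sub>R y \<in> {0<..<c}"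
      using xy t by (intro convexD) auto
    show "(deriv ^^ n) F ((1 - t) *\<^sub>R x + t *\<^sub>R y) \<le> (1 - t) * (deriv ^^ n) F x + t * (deriv ^^ n) F y"
    proof (rule LIMSEQ_le)
      show "(\<lambda>i. g i n ((1 - t) *\<^sub>R x + t *\<^sub>R y)) \<longlonglongrightarrow> (deriv ^^ n) F ((1 - t) *\<^sub>R x + t *\<^sub>R y)"
        using deriv_lim in_c by blast
      show "(\<lambda>i. (1 - t) * g i n x + t * g i n y) \<longlonglongrightarrow> (1 - t) * (deriv ^^ n) F x + t * (deriv ^^ n) F y"
        using deriv_lim xy by (intro tendsto_intros) auto
      show "\<exists>N. \<forall>i\<ge>N. g i n ((1 - t) *\<^sub>R x + t *\<^sub>R y) \<le> (1 - t) * g i n x + t * g i n y"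
        using convex_onD[OF cvx] t xy by auto
    qed
  qed simp
  show "mono_on {0<..<c} ((deriv ^^ n) F)"
  proof (rule mono_onI)
    fix x y assume xy: "x \<in> {0<..<c}" "y \<in> {0<..<c}" "x \<le> y"
    have "g i n x \<le> g i n y" for i
      using xy nonneg by (intro deriv_chain_nonneg_mono[OF chain]) auto
    then show "(deriv ^^ n) F x \<le> (deriv ^^ n) F y"
      using deriv_lim xy by (intro LIMSEQ_le[of "\<lambda>i. g i n x" _ "\<lambda>i. g i n y"]) auto
  qed
qed

section \<open>Continuity of the transform\<close>

text \<open>Let \<open>L\<close> and \<open>R\<close> be the one-sided limits at \<open>x\<close>. Choose the three points \<open>c\<close>, \<open>c u\<close>, \<open>c u\<^sup>2\<close> close to
  \<open>x\<close> with only the last one to its left; the inequality becomes \<open>R\<^sup>2 \<le> R L\<close> in the limit, and so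
  \<open>R \<le> L\<close>.\<close>

lemma mono_mult_mid_convex_continuous:
  fixes F :: "real \<Rightarrow> real"
  assumes I: "I = {x. 0 < x \<and> ereal x < \<rho>}"
    and nonneg: "\<And>x. x \<in> I \<Longrightarrow> 0 \<le> F x"
    and mono: "mono_on I F"
    and mid: "\<And>c u. c \<in> I \<Longrightarrow> 0 < u \<Longrightarrow> u < 1 \<Longrightarrow> (F (c * u))\<^sup>2 \<le> F c * F (c * u\<^sup>2)"
  shows "continuous_on I F"
proof -
  have down: "y \<in> I" if "x \<in> I" "0 < y" "y \<le> x" for x y
    using that unfolding I by (auto intro: le_less_trans[of "ereal y" "ereal x"])
  have "isCont F x" if x: "x \<in> I" for x
  proof -
    have x0: "0 < x" "ereal x < \<rho>" using x by (auto simp: I)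
    define L where "L = Sup (F ` {0<..<x})"
    define R where "R = Inf (F ` {y \<in> I. x < y})"
    obtain z where z: "z \<in> I" "x < z"
      using ereal_dense2[OF x0(2)] x0 by (auto simp: I)
    have right_ne: "F ` {y \<in> I. x < y} \<noteq> {}" using z by auto
    have left_ne: "F ` {0<..<x} \<noteq> {}" using dense[OF x0(1)] by auto
    have left_le: "F y \<le> F x" if "y \<in> {0<..<x}" for y
      using mono down[OF x, of y] x that by (auto simp: mono_on_def)
    have right_ge: "F x \<le> F y" if "y \<in> {y \<in> I. x < y}" for y
      using mono x that by (auto simp: mono_on_def)
    have left_bdd: "bdd_above (F ` {0<..<x})" using left_le by (rule bdd_aboveI2)
    have right_bdd: "bdd_below (F ` {y \<in> I. x < y})" using right_ge by (rule bdd_belowI2)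
    have L: "L \<le> F x" unfolding L_def using left_ne left_le by (intro cSup_least) auto
    have R: "F x \<le> R" unfolding R_def using right_ne right_ge by (intro cInf_greatest) auto
    have L0: "0 \<le> L"
    proof -
      obtain y where y: "0 < y" "y < x" using dense[OF x0(1)] by blast
      have "F y \<le> L" unfolding L_def using left_bdd y by (intro cSup_upper) auto
      with nonneg[OF down[OF x, of y]] y show ?thesis by simp
    qed
    have R0: "0 \<le> R" using R nonneg[OF x] by simp
    have key: "R\<^sup>2 \<le> F y * L" if y: "y \<in> I" "x < y" for y
    proof -
      \<comment> \<open>With \<open>s\<^sup>3 = y / x\<close> and \<open>u = 1 / s\<^sup>2\<close> the points are \<open>x s\<^sup>3\<close>, \<open>x s\<close> and \<open>x / s\<close>.\<close>
      define s where "s = root 3 (y / x)"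
      have s: "1 < s" "s ^ 3 = y / x"
        using y x0 by (auto simp: s_def)
      have yx: "y = x * s ^ 3" using s x0 by (simp add: field_simps)
      define u where "u = inverse (s\<^sup>2)"
      have "1 < s\<^sup>2" using s by (simp add: one_less_power)
      then have u: "0 < u" "u < 1" by (auto simp: u_def inverse_less_1_iff)
      have yu: "y * u = x * s" and yuu: "y * u\<^sup>2 = x / s"
        using s(1) unfolding yx u_def by (auto simp: field_simps power2_eq_square power3_eq_cube)
      have "x < y * u" unfolding yu using s x0 by simp
      moreover have "y * u \<le> y" using u y x0 by (simp add: mult_left_le)
      ultimately have "y * u \<in> {y \<in> I. x < y}" using down[OF y(1)] x0 by auto
      then have "R \<le> F (y * u)" unfolding R_def using right_bdd by (intro cInf_lower) auto
      then have "R\<^sup>2 \<le> (F (y * u))\<^sup>2" using R0 by (rule power_mono)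
      also have "\<dots> \<le> F y * F (y * u\<^sup>2)" using mid y u by blast
      also have "\<dots> \<le> F y * L"
      proof (rule mult_left_mono)
        have "y * u\<^sup>2 \<in> {0<..<x}" unfolding yuu using s x0 by (auto simp: divide_less_eq)
        then show "F (y * u\<^sup>2) \<le> L" unfolding L_def using left_bdd by (intro cSup_upper) auto
      qed (use nonneg y in auto)
      finally show ?thesis .
    qed
    have "R \<le> L"
    proof (cases "L = 0")
      case True
      then have "R\<^sup>2 \<le> 0" using key[OF z] by simp
      then show ?thesis using True by simp
    next
      case False
      \<comment> \<open>Now \<open>y\<close> decreases to \<open>x\<close>: only the occurrence of \<open>R\<close> on the right is expanded as an infimum.\<close>
      then have "R\<^sup>2 / L \<le> R"
        using key right_ne L0
        by (subst (2) R_def, intro cInf_greatest) (auto simp: divide_le_eq)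
      then have "R * R \<le> R * L" using False L0 by (simp add: field_simps power2_eq_square)
      then show ?thesis using R0 L0 by (cases "R = 0") auto
    qed
    with L R have eq: "L = F x" "R = F x" by auto
    have I_near: "\<forall>\<^sub>F y in at x. 0 < y" "\<forall>\<^sub>F y in at x. y < z"
      using order_tendstoD[OF tendsto_ident_at[of x UNIV]] x0 z by auto
    have "(F \<longlongrightarrow> F x) (at x)"
    proof (rule order_tendstoI)
      fix a assume "a < F x"
      then obtain w where w: "w \<in> {0<..<x}" "a < F w"
        using less_cSup_iff[OF left_ne left_bdd, of a] eq unfolding L_def by auto
      have "\<forall>\<^sub>F y in at x. w < y"
        using order_tendstoD(1)[OF tendsto_ident_at[of x UNIV]] w by auto
      with I_near(2) show "\<forall>\<^sub>F y in at x. a < F y"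
      proof eventually_elim
        case (elim y)
        then have "F w \<le> F y"
          using mono down[OF z(1), of w] down[OF z(1), of y] w x0 z by (auto simp: mono_on_def)
        with w show ?case by simp
      qed
    next
      fix a assume "F x < a"
      then obtain w where w: "w \<in> I" "x < w" "F w < a"
        using cInf_less_iff[OF right_ne right_bdd, of a] eq unfolding R_def by auto
      have "\<forall>\<^sub>F y in at x. y < w"
        using order_tendstoD(2)[OF tendsto_ident_at[of x UNIV]] w by auto
      with I_near(1) show "\<forall>\<^sub>F y in at x. F y < a"
      proof eventually_elim
        case (elim y)
        then have "F y \<le> F w"
          using mono down[OF w(1), of y] w by (auto simp: mono_on_def)
        with w show ?case by simp
      qed
    qed
    then show ?thesis by (simp add: isCont_def)
  qed
  then show ?thesis by (simp add: continuous_at_imp_continuous_on)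
qed

text \<open>Masses \<open>y - x\<close> at \<open>0\<close> and \<open>x\<close> at \<open>1\<close> have the moments \<open>y, x, x\<close>, and nonnegativity of the determinant
  gives \<open>F x * F x \<le> F y * F x\<close>.\<close>

lemma transform_01_nonneg_mono:
  fixes \<rho> :: ereal
  assumes I: "I = {x. 0 < x \<and> ereal x < \<rho>}"
    and transform: "\<forall>s \<in> bounded_moment_seqs \<rho> 2 {0, 1}.
           positive_entries s \<longrightarrow> map F s \<in> moment_seqs 2 UNIV"
  shows "\<forall>x\<in>I. 0 \<le> F x" and "mono_on I F"
proof -
  have key: "0 \<le> F y \<and> (F x)\<^sup>2 \<le> F y * F x" if xy: "x \<in> I" "y \<in> I" "x \<le> y" for x y
  proof -
    define w where "w t = (if t = 0 then y - x else x)" for t :: real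
    have pos: "0 < x" "0 < y" "0 < \<rho>"
      using xy by (auto simp: I intro: less_trans[of 0 "ereal x"])
    have neg: "- \<rho> < ereal t" if "0 < t" for t
      using pos that by (cases \<rho>) auto
    have "map (\<lambda>k. \<Sum>t\<in>{0, 1}. w t * t ^ k) [0..<2 + 1] \<in> moment_seqs 2 {0, 1}"
      using xy pos by (intro atomic_moment_seq) (auto simp: w_def)
    moreover have "map (\<lambda>k. \<Sum>t\<in>{0, 1}. w t * t ^ k) [0..<2 + 1] = [y, x, x]"
      by (simp add: w_def upt_rec)
    ultimately have "[y, x, x] \<in> bounded_moment_seqs \<rho> 2 {0, 1}"
      using xy pos neg by (auto simp: bounded_moment_seqs_def I)
    then have "map F [y, x, x] \<in> moment_seqs 2 UNIV"
      using transform pos by (auto simp: positive_entries_def)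
    then have "[F y, F x, F x] \<in> moment_seqs 2 UNIV" by simp
    from moment_seq_2_discriminant[OF this] show ?thesis by simp
  qed
  show nonneg: "\<forall>x\<in>I. 0 \<le> F x" using key by blast
  show "mono_on I F"
  proof (rule mono_onI)
    fix x y assume xy: "x \<in> I" "y \<in> I" "x \<le> y"
    show "F x \<le> F y"
    proof (cases "F x = 0")
      case False
      then have "0 < F x" using nonneg xy by (simp add: order_less_le)
      then show ?thesis using key[OF xy] by (simp add: power2_eq_square)
    qed (use nonneg xy in simp)
  qed
qed

lemma transform_point_mult_mid_convex:
  fixes \<rho> :: ereal
  assumes u: "0 < u" "u < 1"
    and transform: "\<forall>s \<in> bounded_moment_seqs \<rho> 2 {u}.
           positive_entries s \<longrightarrow> map F s \<in> moment_seqs 2 UNIV"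
    and c: "0 < c" "ereal c < \<rho>"
  shows "(F (c * u))\<^sup>2 \<le> F c * F (c * u\<^sup>2)"
proof -
  have pos: "0 < \<rho>" using c by (auto intro: less_trans[of 0 "ereal c"])
  have neg: "- \<rho> < ereal t" if "0 < t" for t
    using pos that by (cases \<rho>) auto
  have small: "ereal t < \<rho>" if "t \<le> c" for t
    using c(2) that by (auto intro: le_less_trans[of "ereal t" "ereal c"])
  have "c * u \<le> c" "c * u\<^sup>2 \<le> c"
    using c u by (simp_all add: mult_left_le power_le_one)
  moreover have "map (\<lambda>k. \<Sum>t\<in>{u}. c * t ^ k) [0..<2 + 1] \<in> moment_seqs 2 {u}"
    using c by (intro atomic_moment_seq[where w = "\<lambda>_. c"]) auto
  moreover have "map (\<lambda>k. \<Sum>t\<in>{u}. c * t ^ k) [0..<2 + 1] = [c, c * u, c * u\<^sup>2]"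
    by (simp add: upt_rec numeral_2_eq_2)
  ultimately have "[c, c * u, c * u\<^sup>2] \<in> bounded_moment_seqs \<rho> 2 {u}"
    using c u neg small by (simp add: bounded_moment_seqs_def)
  then have "positive_entries [c, c * u, c * u\<^sup>2] \<longrightarrow> map F [c, c * u, c * u\<^sup>2] \<in> moment_seqs 2 UNIV"
    by (rule bspec[OF transform])
  then have "[F c, F (c * u), F (c * u\<^sup>2)] \<in> moment_seqs 2 UNIV"
    using c u by (simp add: positive_entries_def)
  from moment_seq_2_discriminant(2)[OF this] show ?thesis .
qed

section \<open>Derivatives of the transform\<close>

theorem theorem4p4:
  fixes F :: "real \<Rightarrow> real" and \<rho> :: ereal and I :: "real set" and N :: nat and u\<^sub>0 :: real
  assumes "0 < \<rho>"
    and "I = {x. 0 < x \<and> ereal x < \<rho>}"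
    and "3 \<le> N"
    and "0 < u\<^sub>0" and "u\<^sub>0 < 1"
    and "\<forall>s \<in> bounded_moment_seqs \<rho> (2 * N - 2) {1, u\<^sub>0}.
           positive_entries s \<longrightarrow> map F s \<in> raised_moment_seqs (2 * N - 2)"
    and "\<forall>s \<in> bounded_moment_seqs \<rho> 2 {0, 1}.
           positive_entries s \<longrightarrow> map F s \<in> moment_seqs 2 UNIV"
    and "(\<forall>u. 0 < u \<and> u < 1 \<longrightarrow> (\<forall>s \<in> bounded_moment_seqs \<rho> 2 {u}.
           positive_entries s \<longrightarrow> map F s \<in> moment_seqs 2 UNIV))
         \<or> continuous_on I F"
  shows "Ck_on (N - 3) I F
    \<and> (\<forall>k \<le> N - 3. \<forall>x\<in>I. 0 \<le> (deriv ^^ k) F x)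
    \<and> convex_on I ((deriv ^^ (N - 3)) F)
    \<and> mono_on I ((deriv ^^ (N - 3)) F)
    \<and> (Ck_on (N - 1) I F \<longrightarrow> (\<forall>k \<le> N - 1. \<forall>x\<in>I. 0 \<le> (deriv ^^ k) F x))"
proof -
  note I = assms(2) and u = assms(4,5)
  define n where "n = N - 3"
  have N: "N - 1 = n + 2" "2 * N - 2 = 2 * (n + 2)" using \<open>3 \<le> N\<close> unfolding n_def by arith+
  have cont: "continuous_on I F"
    using assms(8)
  proof
    assume pt: "\<forall>u. 0 < u \<and> u < 1 \<longrightarrow> (\<forall>s \<in> bounded_moment_seqs \<rho> 2 {u}.
           positive_entries s \<longrightarrow> map F s \<in> moment_seqs 2 UNIV)"
    show ?thesis
    proof (rule mono_mult_mid_convex_continuous[OF I])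
      fix c u :: real assume c: "c \<in> I" and u: "0 < u" "u < 1"
      have "0 < c" "ereal c < \<rho>" using c by (simp_all add: I)
      then show "(F (c * u))\<^sup>2 \<le> F c * F (c * u\<^sup>2)"
        using u pt by (intro transform_point_mult_mid_convex) blast+
    qed (use transform_01_nonneg_mono[OF I assms(7)] in blast)+
  qed
  have hankel: "hankel_nonneg u\<^sub>0 k C F" if "k \<le> n + 2" "ereal C \<le> \<rho>" for k C
    using hankel_nonneg_of_moment_transform[OF u assms(6)[unfolded N] that] .
  have sub_I: "{0<..<C} \<subseteq> I" if "ereal C \<le> \<rho>" for C
    using that unfolding I by (auto intro: less_le_trans[of "ereal _" "ereal C"])
  have above: "\<exists>c. x < c \<and> ereal c < \<rho>" if "x \<in> I" for x
    using that ereal_dense2[of "ereal x" \<rho>] by (auto simp: I)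
  \<comment> \<open>The conclusions concern one or two points of \<open>I\<close> at a time, and these lie in some \<open>{0<..<c}\<close>
    with \<open>c < \<rho>\<close>, even when \<open>\<rho> = \<infinity>\<close>.\<close>
  have regular: "\<And>l x. l < n \<Longrightarrow> x \<in> {0<..<c} \<Longrightarrow> (deriv ^^ l) F field_differentiable at x"
      "\<And>l x. l \<le> n \<Longrightarrow> x \<in> {0<..<c} \<Longrightarrow> 0 \<le> (deriv ^^ l) F x"
      "convex_on {0<..<c} ((deriv ^^ n) F)" "mono_on {0<..<c} ((deriv ^^ n) F)"
    if c: "0 < c" "ereal c < \<rho>" for c
  proof -
    have "c \<in> I" using c by (simp add: I)
    from above[OF this] obtain C where C: "c < C" "ereal C < \<rho>" by blast
    have cont_C: "continuous_on {0<..<C} F"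
      using cont sub_I[of C] C by (meson continuous_on_subset less_imp_le)
    have hankel_C: "hankel_nonneg u\<^sub>0 k C F" if "k \<le> n + 2" for k
      using hankel[OF that] C by simp
    note * = hankel_nonneg_imp_regular[OF u c(1) C(1) cont_C hankel_C]
    show "\<And>l x. l < n \<Longrightarrow> x \<in> {0<..<c} \<Longrightarrow> (deriv ^^ l) F field_differentiable at x"
      "\<And>l x. l \<le> n \<Longrightarrow> x \<in> {0<..<c} \<Longrightarrow> 0 \<le> (deriv ^^ l) F x"
      "convex_on {0<..<c} ((deriv ^^ n) F)" "mono_on {0<..<c} ((deriv ^^ n) F)"
      using * by blast+
  qed
  have below: "\<exists>c. 0 < c \<and> ereal c < \<rho> \<and> x \<in> {0<..<c}" if "x \<in> I" for x
    using above[OF that] that unfolding I by (auto intro: less_trans)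
  have nonneg: "0 \<le> (deriv ^^ l) F x" if "l \<le> n" "x \<in> I" for l x
    using below[OF that(2)] regular(2) that(1) by blast
  have diff: "(deriv ^^ l) F field_differentiable at x" if "l < n" "x \<in> I" for l x
    using below[OF that(2)] regular(1) that(1) by blast
  have above2: "\<exists>c>0. x < c \<and> y < c \<and> ereal c < \<rho>" if x: "x \<in> I" and y: "y \<in> I" for x y
  proof -
    obtain c d where "x < c" "ereal c < \<rho>" "y < d" "ereal d < \<rho>"
      using above[OF x] above[OF y] by blast
    moreover have "0 < x" using x by (simp add: I)
    ultimately show ?thesis by (intro exI[of _ "max c d"]) (auto simp: max_def)
  qed
  have I_convex: "convex I"
    unfolding I
    by (intro is_interval_convex, unfold is_interval_1)
      (auto intro: le_less_trans[of "ereal _" "ereal _" \<rho>])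
  have convex: "convex_on I ((deriv ^^ n) F)"
  proof (rule convex_onI[OF _ I_convex])
    fix t x y :: real assume t: "0 < t" "t < 1" and xy: "x \<in> I" "y \<in> I"
    obtain c where "0 < c" "x < c" "y < c" "ereal c < \<rho>" using above2[OF xy] by blast
    then have "convex_on {0<..<c} ((deriv ^^ n) F)" "x \<in> {0<..<c}" "y \<in> {0<..<c}"
      using regular[of c] xy by (auto simp: I)
    then show "(deriv ^^ n) F ((1 - t) *\<^sub>R x + t *\<^sub>R y) \<le> (1 - t) * (deriv ^^ n) F x + t * (deriv ^^ n) F y"
      using t by (intro convex_onD) auto
  qed
  have mono: "mono_on I ((deriv ^^ n) F)"
  proof (rule mono_onI)
    fix x y assume xy: "x \<in> I" "y \<in> I" "x \<le> y"
    obtain c where "0 < c" "x < c" "y < c" "ereal c < \<rho>" using above2[OF xy(1,2)] by blast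
    then have "mono_on {0<..<c} ((deriv ^^ n) F)" "x \<in> {0<..<c}" "y \<in> {0<..<c}"
      using regular[of c] xy by (auto simp: I)
    then show "(deriv ^^ n) F x \<le> (deriv ^^ n) F y"
      using xy(3) by (auto simp: mono_on_def)
  qed
  have I_open: "open I"
  proof (subst open_subopen, intro ballI)
    fix x assume "x \<in> I"
    then obtain c where "ereal c < \<rho>" "x \<in> {0<..<c}" using below by blast
    then show "\<exists>T. open T \<and> x \<in> T \<and> T \<subseteq> I"
      using sub_I[of c] by (intro exI[of _ "{0<..<c}"]) simp
  qed
  have "Ck_on n I F"
    unfolding Ck_on_def using diff convex_on_continuous[OF I_open convex] by blast
  moreover have "0 \<le> (deriv ^^ k) F x" if Ck: "Ck_on (n + 2) I F" and k: "k \<le> n + 2" and x: "x \<in> I" for k x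
  proof -
    obtain c where c: "x < c" "ereal c < \<rho>" using above[OF x] by blast
    have c_sub: "{0<..<c} \<subseteq> I" using sub_I c by simp
    have diff': "((deriv ^^ l) F has_real_derivative (deriv ^^ Suc l) F y) (at y)"
      if "l < n + 2" "y \<in> I" for l y
      using Ck that by (simp add: Ck_on_def DERIV_deriv_iff_field_differentiable)
    have "continuous_on I ((deriv ^^ k) F)"
    proof (cases "k = n + 2")
      case True
      then show ?thesis using Ck by (simp add: Ck_on_def)
    next
      case False
      then show ?thesis
        using diff'[of k] k by (intro continuous_at_imp_continuous_on ballI) (auto intro: DERIV_isCont)
    qed
    then have cont_c: "continuous_on {0<..<c} ((deriv ^^ k) F)"
      using c_sub by (rule continuous_on_subset)
    have "deriv_chain k {0<..<c} (\<lambda>l. (deriv ^^ l) F)"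
      unfolding deriv_chain_def using diff' k c_sub by auto
    then show ?thesis
      using hankel_nonneg_imp_derivative_nonneg[OF u, of k c "\<lambda>l. (deriv ^^ l) F" x]
        hankel[OF k, of c] cont_c c x by (auto simp: I)
  qed
  ultimately show ?thesis
    unfolding N n_def[symmetric] using nonneg convex mono by blast
qed

end
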